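(* Let $\mathscr{D}$ be a nonempty symmetric domain of $\mathbb{R}^2$ and let $\mathcal{M}_\mathscr{D}$ be the set of mean functions on $\mathscr{D}$. Define, for $M_1,M_2\in\mathcal{M}_\mathscr{D}$ and $(x,y)\in\mathscr{D}$, $$(M_1*M_2)(x,y):=\begin{cases}\dfrac{x\,(M_1(x,y)-y)(M_2(x,y)-y)+y\,(M_1(x,y)-x)(M_2(x,y)-x)}{(M_1(x,y)-y)(M_2(x,y)-y)+(M_1(x,y)-x)(M_2(x,y)-x)} & \text{if } x\neq y,\\ x & \text{if } x=y.\end{cases}$$ Then $*$ is an internal composition law on $\mathcal{M}_\mathscr{D}$ (i.e. $M_1*M_2\in\mathcal{M}_\mathscr{D}$), and $(\mathcal{M}_\mathscr{D},* )$ is an abelian group whose neutral element is the arithmetic mean $\mathrm{A}(x,y)=\frac{x+y}{2}$ on $\mathscr{D}$. Moreover, the map $\varphi:\mathcal{M}_\mathscr{D}\to\mathcal{A}_\mathscr{D}$ defined by $$\varphi(M)(x,y):=\begin{cases}\log\left(-\dfrac{M(x,y)-x}{M(x,y)-y}\right) & \text{if } x\neq y,\\ 0 & \text{if } x=y,\end{cases}$$ is well defined and is a group isomorphism from $(\mathcal{M}_\mathscr{D},* )$ onto $(\mathcal{A}_\mathscr{D},+)$.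
   Context: A symmetric domain of $\mathbb{R}^2$ is a set $\mathscr{D}\subseteq\mathbb{R}^2$ such that $(x,y)\in\mathscr{D}$ implies $(y,x)\in\mathscr{D}$. A mean function (mean) on $\mathscr{D}$ is a function $M:\mathscr{D}\to\mathbb{R}$ such that: (i) $M(x,y)=M(y,x)$ for all $(x,y)\in\mathscr{D}$; (ii) $\min(x,y)\le M(x,y)\le\max(x,y)$ for all $(x,y)\in\mathscr{D}$; (iii) for all $(x,y)\in\mathscr{D}$, $M(x,y)=x$ implies $x=y$. $\mathcal{A}_\mathscr{D}$ denotes the set of asymmetric maps on $\mathscr{D}$, i.e. maps $f:\mathscr{D}\to\mathbb{R}$ with $f(x,y)=-f(y,x)$ for all $(x,y)\in\mathscr{D}$; it is an abelian group under pointwise addition $+$. *)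

theory Defs
  imports Complex_Main "HOL-Algebra.Group"
begin

text \<open>
  Maps from D to the reals are represented by functions that are \<^const>\<open>extensional\<close> on D
  (fixed to \<^const>\<open>undefined\<close> outside D), so that HOL equality is equality of maps on D.
  A symmetric domain is a set of pairs satisfying the library predicate \<^const>\<open>sym\<close>.
\<close>

definition mean_functions :: "(real \<times> real) set \<Rightarrow> (real \<times> real \<Rightarrow> real) set" where
  "mean_functions D = {M \<in> extensional D.
     (\<forall>x y. (x, y) \<in> D \<longrightarrow> M (x, y) = M (y, x)) \<and>
     (\<forall>x y. (x, y) \<in> D \<longrightarrow> min x y \<le> M (x, y) \<and> M (x, y) \<le> max x y) \<and>
     (\<forall>x y. (x, y) \<in> D \<longrightarrow> M (x, y) = x \<longrightarrow> x = y)}"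

definition asymmetric_maps :: "(real \<times> real) set \<Rightarrow> (real \<times> real \<Rightarrow> real) set" where
  "asymmetric_maps D = {f \<in> extensional D. \<forall>x y. (x, y) \<in> D \<longrightarrow> f (x, y) = - f (y, x)}"

definition mean_comp ::
  "(real \<times> real) set \<Rightarrow> (real \<times> real \<Rightarrow> real) \<Rightarrow> (real \<times> real \<Rightarrow> real) \<Rightarrow> (real \<times> real \<Rightarrow> real)" where
  "mean_comp D M1 M2 = (\<lambda>(x, y) \<in> D.
     if x \<noteq> y then
       (x * (M1 (x, y) - y) * (M2 (x, y) - y) + y * (M1 (x, y) - x) * (M2 (x, y) - x)) /
       ((M1 (x, y) - y) * (M2 (x, y) - y) + (M1 (x, y) - x) * (M2 (x, y) - x))
     else x)"

definition arithmetic_mean :: "(real \<times> real) set \<Rightarrow> (real \<times> real \<Rightarrow> real)" where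
  "arithmetic_mean D = (\<lambda>(x, y) \<in> D. (x + y) / 2)"

definition mean_group :: "(real \<times> real) set \<Rightarrow> (real \<times> real \<Rightarrow> real) monoid" where
  "mean_group D =
     \<lparr>carrier = mean_functions D, monoid.mult = mean_comp D, one = arithmetic_mean D\<rparr>"

definition asymmetric_group :: "(real \<times> real) set \<Rightarrow> (real \<times> real \<Rightarrow> real) monoid" where
  "asymmetric_group D =
     \<lparr>carrier = asymmetric_maps D, monoid.mult = (\<lambda>f g. \<lambda>p \<in> D. f p + g p), one = (\<lambda>p \<in> D. 0)\<rparr>"

definition mean_log ::
  "(real \<times> real) set \<Rightarrow> (real \<times> real \<Rightarrow> real) \<Rightarrow> (real \<times> real \<Rightarrow> real)" where
  "mean_log D M = (\<lambda>(x, y) \<in> D.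
     if x \<noteq> y then ln (- ((M (x, y) - x) / (M (x, y) - y))) else 0)"

end

theory Submission
  imports Defs
begin

text \<open>
  For \<open>x \<noteq> y\<close>, a mean \<open>M\<close> is determined by \<open>r = - (M - x) / (M - y)\<close>, which ranges over the
  positive reals, and \<open>M = (x + r y) / (1 + r)\<close>. Symmetry of \<open>M\<close> says that exchanging \<open>x\<close> and \<open>y\<close>
  inverts \<open>r\<close>, and the composition of means multiplies the values of \<open>r\<close>. So \<open>r = e\<^sup>f\<close> with
  \<open>f\<close> an asymmetric map, and the group structure on means is transported from these.
\<close>

section \<open>Weighted means of two numbers\<close>

definition weighted_mean :: "real \<Rightarrow> real \<Rightarrow> real \<Rightarrow> real" where
  "weighted_mean r x y = (x + r * y) / (1 + r)"

text \<open>This is the inverse of \<open>mean_log D\<close>. The diagonal is covered by the same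
  formula, because the weighted mean of equal numbers is that number.\<close>

definition mean_exp ::
  "(real \<times> real) set \<Rightarrow> (real \<times> real \<Rightarrow> real) \<Rightarrow> (real \<times> real \<Rightarrow> real)" where
  "mean_exp D f = (\<lambda>(x, y) \<in> D. weighted_mean (exp (f (x, y))) x y)"

lemma weighted_mean_diff:
  assumes "r > 0"
  shows "weighted_mean r x y - y = (x - y) / (1 + r)"
    and "weighted_mean r x y - x = - (r * (x - y) / (1 + r))"
  using assms by (simp_all add: weighted_mean_def field_simps)

lemma weighted_mean_bounds:
  assumes "r > 0"
  shows "min x y \<le> weighted_mean r x y" and "weighted_mean r x y \<le> max x y"
proof -
  have "min x y + r * min x y \<le> x + r * y"
    using assms by (intro add_mono mult_left_mono) auto
  then show "min x y \<le> weighted_mean r x y"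
    using assms by (simp add: weighted_mean_def pos_le_divide_eq algebra_simps)
  have "x + r * y \<le> max x y + r * max x y"
    using assms by (intro add_mono mult_left_mono) auto
  then show "weighted_mean r x y \<le> max x y"
    using assms by (simp add: weighted_mean_def pos_divide_le_eq algebra_simps)
qed

lemma weighted_mean_eq_left_iff:
  assumes "r > 0"
  shows "weighted_mean r x y = x \<longleftrightarrow> x = y"
  using weighted_mean_diff(2)[OF assms, of x y] assms by auto

lemma weighted_mean_same [simp]:
  assumes "r > 0"
  shows "weighted_mean r x x = x"
  using assms by (simp add: weighted_mean_eq_left_iff)

text \<open>Multiplying numerator and denominator by \<open>r\<close> turns the left side into the
  right one. This gives the symmetry of the means built by \<open>mean_exp\<close>.\<close>

lemma weighted_mean_swap:
  assumes "r > 0"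
  shows "weighted_mean (inverse r) y x = weighted_mean r x y"
proof -
  have "y + inverse r * x = inverse r * (x + r * y)" and "1 + inverse r = inverse r * (1 + r)"
    using assms by (simp_all add: algebra_simps)
  then show ?thesis
    using assms unfolding weighted_mean_def by simp
qed

lemma weighted_mean_ratio:
  assumes "r > 0" "x \<noteq> y"
  shows "- ((weighted_mean r x y - x) / (weighted_mean r x y - y)) = r"
  using assms by (simp add: weighted_mean_diff)

text \<open>Solving \<open>r = - ((m - x) / (m - y))\<close> for \<open>m\<close> gives the weighted
  mean; its denominator \<open>1 + r\<close> is \<open>(x - y) / (m - y)\<close>, which is
  nonzero.\<close>

lemma weighted_mean_of_ratio:
  fixes m x y :: real
  assumes "m \<noteq> y" "x \<noteq> y"
  shows "weighted_mean (- ((m - x) / (m - y))) x y = m"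
proof -
  have "1 + - ((m - x) / (m - y)) = (x - y) / (m - y)"
    and "x + - ((m - x) / (m - y)) * y = m * ((x - y) / (m - y))"
    using assms by (simp_all add: field_simps)
  then show ?thesis
    using assms unfolding weighted_mean_def by simp
qed

lemma weighted_mean_comp:
  assumes "r > 0" "s > 0" "x \<noteq> y"
  defines "m \<equiv> weighted_mean r x y" and "n \<equiv> weighted_mean s x y"
  shows "(m - y) * (n - y) + (m - x) * (n - x) \<noteq> 0" (is "?d \<noteq> 0")
    and "(x * (m - y) * (n - y) + y * (m - x) * (n - x)) /
      ((m - y) * (n - y) + (m - x) * (n - x)) = weighted_mean (r * s) x y" (is "?n / _ = _")
proof -
  \<comment> \<open>The product of the two differences from \<open>y\<close>. The product of the
    differences from \<open>x\<close> is \<open>r * s\<close> times as large, so \<open>c\<close>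
    cancels from the quotient and the weight \<open>r * s\<close> remains.\<close>
  define c where "c = ((x - y) / (1 + r)) * ((x - y) / (1 + s))"
  have c: "c \<noteq> 0"
    using assms by (simp add: c_def)
  have y: "(m - y) * (n - y) = c"
    using assms by (simp add: c_def weighted_mean_diff)
  have x: "(m - x) * (n - x) = r * s * c"
    using assms by (simp add: c_def weighted_mean_diff)
  have d: "?d = (1 + r * s) * c"
    unfolding x y by (simp add: algebra_simps)
  have n: "?n = (x + r * s * y) * c"
    unfolding mult.assoc x y by (simp add: algebra_simps)
  have "1 + r * s > 0"
    using assms by (simp add: add_pos_pos)
  then show "?d \<noteq> 0"
    using c by (simp add: d)
  show "?n / ?d = weighted_mean (r * s) x y"
    using c by (simp add: d n weighted_mean_def)
qed

section \<open>The group of asymmetric maps\<close>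

lemma asymmetric_mapsD:
  assumes "f \<in> asymmetric_maps D" "(x, y) \<in> D"
  shows "f (x, y) = - f (y, x)"
  using assms unfolding asymmetric_maps_def by blast

lemma asymmetric_maps_diag:
  assumes "f \<in> asymmetric_maps D" "(x, x) \<in> D"
  shows "f (x, x) = 0"
  using asymmetric_mapsD[OF assms] by simp

context
  fixes D :: "(real \<times> real) set"
  assumes sym: "sym D"
begin

lemma asymmetric_maps_restrictI:
  assumes "\<And>x y. (x, y) \<in> D \<Longrightarrow> f (x, y) = - f (y, x)"
  shows "restrict f D \<in> asymmetric_maps D"
proof -
  have "restrict f D (x, y) = - restrict f D (y, x)" if "(x, y) \<in> D" for x y
    using assms[OF that] that symD[OF sym that] by simp
  then show ?thesis
    unfolding asymmetric_maps_def by blast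
qed

lemma asymmetric_maps_add:
  assumes "f \<in> asymmetric_maps D" "g \<in> asymmetric_maps D"
  shows "(\<lambda>p \<in> D. f p + g p) \<in> asymmetric_maps D"
proof (rule asymmetric_maps_restrictI)
  fix x y assume "(x, y) \<in> D"
  with asymmetric_mapsD[OF assms(1) this] asymmetric_mapsD[OF assms(2) this]
  show "f (x, y) + g (x, y) = - (f (y, x) + g (y, x))" by linarith
qed

lemma asymmetric_maps_uminus:
  assumes "f \<in> asymmetric_maps D"
  shows "(\<lambda>p \<in> D. - f p) \<in> asymmetric_maps D"
  by (rule asymmetric_maps_restrictI) (use asymmetric_mapsD[OF assms] in metis)

lemma comm_group_asymmetric_group: "comm_group (asymmetric_group D)"
proof (rule comm_groupI)
  fix f assume f: "f \<in> carrier (asymmetric_group D)"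
  then have ext: "f \<in> extensional D"
    by (simp add: asymmetric_group_def asymmetric_maps_def)
  show "\<one>\<^bsub>asymmetric_group D\<^esub> \<otimes>\<^bsub>asymmetric_group D\<^esub> f = f"
    by (rule extensionalityI[OF _ ext]) (simp_all add: asymmetric_group_def)
  have "(\<lambda>p \<in> D. - f p) \<in> carrier (asymmetric_group D)"
    using f by (simp add: asymmetric_group_def asymmetric_maps_uminus)
  moreover have "(\<lambda>p \<in> D. - f p) \<otimes>\<^bsub>asymmetric_group D\<^esub> f = \<one>\<^bsub>asymmetric_group D\<^esub>"
    by (rule extensionalityI[of _ D]) (simp_all add: asymmetric_group_def)
  ultimately show
    "\<exists>g \<in> carrier (asymmetric_group D). g \<otimes>\<^bsub>asymmetric_group D\<^esub> f = \<one>\<^bsub>asymmetric_group D\<^esub>"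
    by blast
next
  fix f g assume "f \<in> carrier (asymmetric_group D)" "g \<in> carrier (asymmetric_group D)"
  then show "f \<otimes>\<^bsub>asymmetric_group D\<^esub> g \<in> carrier (asymmetric_group D)"
    by (simp add: asymmetric_group_def asymmetric_maps_add)
next
  show "\<one>\<^bsub>asymmetric_group D\<^esub> \<in> carrier (asymmetric_group D)"
    by (simp add: asymmetric_group_def asymmetric_maps_restrictI)
next
  fix f g assume "f \<in> carrier (asymmetric_group D)" "g \<in> carrier (asymmetric_group D)"
  show "f \<otimes>\<^bsub>asymmetric_group D\<^esub> g = g \<otimes>\<^bsub>asymmetric_group D\<^esub> f"
    by (simp add: asymmetric_group_def add.commute)
next
  fix f g h
  show "f \<otimes>\<^bsub>asymmetric_group D\<^esub> g \<otimes>\<^bsub>asymmetric_group D\<^esub> h =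
    f \<otimes>\<^bsub>asymmetric_group D\<^esub> (g \<otimes>\<^bsub>asymmetric_group D\<^esub> h)"
    by (rule extensionalityI[of _ D]) (simp_all add: asymmetric_group_def add.assoc)
qed

section \<open>The bijection between asymmetric maps and means\<close>

lemma mean_exp_in_mean_functions:
  assumes "f \<in> asymmetric_maps D"
  shows "mean_exp D f \<in> mean_functions D"
proof -
  have "weighted_mean (exp (f (x, y))) x y = weighted_mean (exp (f (y, x))) y x" 
    if "(x, y) \<in> D" for x y
  proof -
    \<comment> \<open>Exchanging the arguments therefore inverts the weight, as
      \<open>weighted_mean_swap\<close> requires.\<close>
    have "f (y, x) = - f (x, y)"
      using assms symD[OF sym that] by (rule asymmetric_mapsD)
    then show ?thesis
      by (simp add: exp_minus weighted_mean_swap)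
  qed
  then show ?thesis
    by (auto simp: mean_functions_def mean_exp_def weighted_mean_bounds weighted_mean_eq_left_iff
        dest: symD[OF sym])
qed

text \<open>A mean lies strictly between distinct arguments, so its differences from them have
  opposite signs.\<close>

lemma mean_functions_ratio:
  assumes M: "M \<in> mean_functions D" and D: "(x, y) \<in> D" and ne: "x \<noteq> y"
  shows "M (x, y) \<noteq> y" and "0 < - ((M (x, y) - x) / (M (x, y) - y))"
proof -
  \<comment> \<open>The definition only excludes the value \<open>x\<close>; applied at the swapped
    point, together with symmetry, it also excludes \<open>y\<close>.\<close>
  have "(y, x) \<in> D" using D by (rule symD[OF sym])
  then have x: "M (x, y) \<noteq> x" and y: "M (x, y) \<noteq> y"
    and b: "min x y \<le> M (x, y)" "M (x, y) \<le> max x y"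
    using M D ne unfolding mean_functions_def by fastforce+
  show "M (x, y) \<noteq> y" by (rule y)
  show "0 < - ((M (x, y) - x) / (M (x, y) - y))"
    using x y b by (auto simp: divide_less_0_iff min_def max_def split: if_splits)
qed

lemma mean_log_in_asymmetric_maps:
  assumes M: "M \<in> mean_functions D"
  shows "mean_log D M \<in> asymmetric_maps D"
proof -
  have "mean_log D M (x, y) = - mean_log D M (y, x)" if D: "(x, y) \<in> D" for x y
  proof (cases "x = y")
    case False
    have D': "(y, x) \<in> D" using D by (rule symD[OF sym])
    have s: "M (y, x) = M (x, y)"
      using M D unfolding mean_functions_def by fastforce
    have "- ((M (y, x) - y) / (M (y, x) - x)) = inverse (- ((M (x, y) - x) / (M (x, y) - y)))"
      by (simp add: s)
    then show ?thesis
      \<comment> \<open>The deleted simp rule would move the sign out of \<open>inverse\<close> and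
        so hide the term from \<open>ln_inverse\<close>.\<close>
      using False D D' mean_functions_ratio(2)[OF M D False]
      by (simp add: mean_log_def ln_inverse del: inverse_minus_eq)
  qed (use D in \<open>simp add: mean_log_def\<close>)
  then show ?thesis
    by (simp add: asymmetric_maps_def mean_log_def)
qed

lemma mean_exp_mean_log:
  assumes M: "M \<in> mean_functions D"
  shows "mean_exp D (mean_log D M) = M"
proof (rule extensionalityI)
  show "mean_exp D (mean_log D M) \<in> extensional D"
    by (simp add: mean_exp_def)
  show "M \<in> extensional D"
    using M by (simp add: mean_functions_def)
  fix p assume "p \<in> D"
  then obtain x y where p: "p = (x, y)" and D: "(x, y) \<in> D"
    by (cases p) auto
  show "mean_exp D (mean_log D M) p = M p"
  proof (cases "x = y")
    case True
    then have "M (x, x) = x"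
      using M D unfolding mean_functions_def by force
    then show ?thesis
      using D True by (simp add: p mean_exp_def)
  next
    case False
    then show ?thesis
      using D mean_functions_ratio[OF M D False]
      by (simp add: p mean_exp_def mean_log_def weighted_mean_of_ratio)
  qed
qed

lemma mean_log_mean_exp:
  assumes f: "f \<in> asymmetric_maps D"
  shows "mean_log D (mean_exp D f) = f"
proof (rule extensionalityI)
  show "mean_log D (mean_exp D f) \<in> extensional D"
    by (simp add: mean_log_def)
  show "f \<in> extensional D"
    using f by (simp add: asymmetric_maps_def)
  fix p assume "p \<in> D"
  then show "mean_log D (mean_exp D f) p = f p"
    \<comment> \<open>On the diagonal \<open>mean_log\<close> is 0 by definition, and
      \<open>f\<close> vanishes there by asymmetry.\<close>
    using asymmetric_maps_diag[OF f]
    by (cases p) (auto simp: mean_log_def mean_exp_def weighted_mean_ratio)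
qed

section \<open>Transport of the group structure\<close>

lemma mean_exp_mult:
  "mean_exp D (\<lambda>p \<in> D. f p + g p) = mean_comp D (mean_exp D f) (mean_exp D g)"
  by (rule extensionalityI[of _ D])
    (auto simp: mean_exp_def mean_comp_def weighted_mean_comp exp_add)

text \<open>The direction matters: \<open>iso\<close> only asks for a multiplicative bijection, so
  this can be shown before the means are known to form a group.\<close>

lemma mean_exp_iso: "mean_exp D \<in> iso (asymmetric_group D) (mean_group D)"
proof (rule isoI)
  show "mean_exp D \<in> hom (asymmetric_group D) (mean_group D)"
    by (rule homI)
      (simp_all add: asymmetric_group_def mean_group_def mean_exp_in_mean_functions mean_exp_mult)
  show "bij_betw (mean_exp D) (carrier (asymmetric_group D)) (carrier (mean_group D))"
    by (rule bij_betw_byWitness[where f' = "mean_log D"])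
      (auto simp: asymmetric_group_def mean_group_def mean_exp_in_mean_functions
        mean_log_in_asymmetric_maps mean_log_mean_exp mean_exp_mean_log)
qed

lemma mean_exp_one: "mean_exp D \<one>\<^bsub>asymmetric_group D\<^esub> = \<one>\<^bsub>mean_group D\<^esub>"
  by (rule extensionalityI[of _ D])
    (auto simp: mean_exp_def asymmetric_group_def mean_group_def arithmetic_mean_def weighted_mean_def)

text \<open>The library result makes the image a commutative group with the image of the unit as its
  unit; by \<open>mean_exp_one\<close> this is already the unit of
  \<open>mean_group D\<close>.\<close>

lemma comm_group_mean_group: "comm_group (mean_group D)"
  using comm_group.iso_imp_img_comm_group[OF comm_group_asymmetric_group mean_exp_iso]
  by (simp add: mean_exp_one)

lemma mean_log_iso: "mean_log D \<in> iso (mean_group D) (asymmetric_group D)"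
proof -
  interpret A: comm_group "asymmetric_group D" by (rule comm_group_asymmetric_group)
  interpret M: comm_group "mean_group D" by (rule comm_group_mean_group)
  \<comment> \<open>The set-theoretic inverse agrees with \<open>mean_log D\<close> on the carrier,
    which suffices to pass the isomorphism property on.\<close>
  have inv: "inv_into (carrier (asymmetric_group D)) (mean_exp D) M = mean_log D M"
    if "M \<in> carrier (mean_group D)" for M
    using that mean_exp_iso
    by (intro inv_into_f_eq)
      (auto simp: iso_def bij_betw_def asymmetric_group_def mean_group_def
        mean_log_in_asymmetric_maps mean_exp_mean_log)
  show ?thesis
    using A.iso_set_sym[OF mean_exp_iso] inv[symmetric] by (rule M.iso_eq)
qed

end

theorem theorem1:
  fixes D :: "(real \<times> real) set"
  assumes "D \<noteq> {}" and "sym D"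
  shows
    "(\<forall>M1 \<in> mean_functions D. \<forall>M2 \<in> mean_functions D.
        (\<forall>x y. (x, y) \<in> D \<longrightarrow> x \<noteq> y \<longrightarrow>
           (M1 (x, y) - y) * (M2 (x, y) - y) + (M1 (x, y) - x) * (M2 (x, y) - x) \<noteq> 0) \<and>
        mean_comp D M1 M2 \<in> mean_functions D) \<and>
     comm_group (mean_group D) \<and>
     \<one>\<^bsub>mean_group D\<^esub> = arithmetic_mean D \<and>
     (\<forall>M \<in> mean_functions D.
        (\<forall>x y. (x, y) \<in> D \<longrightarrow> x \<noteq> y \<longrightarrow>
           M (x, y) - y \<noteq> 0 \<and> 0 < - ((M (x, y) - x) / (M (x, y) - y))) \<and>
        mean_log D M \<in> asymmetric_maps D) \<and>
     comm_group (asymmetric_group D) \<and>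
     mean_log D \<in> iso (mean_group D) (asymmetric_group D)"
proof -
  note sym = \<open>sym D\<close>
  have "(M1 (x, y) - y) * (M2 (x, y) - y) + (M1 (x, y) - x) * (M2 (x, y) - x) \<noteq> 0"
    if "M1 \<in> mean_functions D" "M2 \<in> mean_functions D" "(x, y) \<in> D" "x \<noteq> y" for M1 M2 x y
  proof -
    \<comment> \<open>Every mean is a weighted mean with a positive weight, so the nonvanishing
      denominator comes from \<open>weighted_mean_comp\<close>.\<close>
    have "M (x, y) = weighted_mean (exp (mean_log D M (x, y))) x y" if "M \<in> mean_functions D" for M
      using arg_cong[OF mean_exp_mean_log[OF sym that], of "\<lambda>M. M (x, y)"] \<open>(x, y) \<in> D\<close>
      by (simp add: mean_exp_def)
    then show ?thesis
      using weighted_mean_comp(1)[OF exp_gt_zero exp_gt_zero \<open>x \<noteq> y\<close>] that(1,2) by metis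
  qed
  moreover have "mean_comp D M1 M2 \<in> mean_functions D"
    if "M1 \<in> mean_functions D" "M2 \<in> mean_functions D" for M1 M2
  proof -
    interpret comm_group "mean_group D" by (rule comm_group_mean_group[OF sym])
    show ?thesis
      using m_closed[of M1 M2] that by (simp add: mean_group_def)
  qed
  ultimately show ?thesis
    using comm_group_mean_group[OF sym] comm_group_asymmetric_group[OF sym] mean_log_iso[OF sym]
      mean_functions_ratio[OF sym] mean_log_in_asymmetric_maps[OF sym]
    by (auto simp: mean_group_def)
qed

end
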